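(* For each integer $k\geq 3$, $\mathcal{W}(\mathbf{\Sigma}^0_k) \leq \mathcal{W}(\mathbf{\Sigma}^0_{k+1})$; that is, there is a continuous function $H : 2^{2^\star} \to 2^{2^\star}$ such that $\mathcal{W}(\mathbf{\Sigma}^0_k) = H^{-1}(\mathcal{W}(\mathbf{\Sigma}^0_{k+1}))$.
   Context: Let $2=\{0,1\}$ be the two-letter alphabet, $2^\star$ the set of finite words over it (including the empty word $\lambda$), and $2^\omega$ the set of infinite words over it, equipped with the Cantor topology (product of discrete topologies). A dictionary is a subset $V \subseteq 2^\star$; its $\omega$-power is $V^\omega = \{u_1\cdot u_2\cdots u_n\cdots \mid \forall i\geq 1,\ u_i \in V\setminus\{\lambda\}\} \subseteq 2^\omega$. Dictionaries are identified with their characteristic functions, i.e. with elements of the space $2^{2^\star}$ of functions $2^\star\to\{0,1\}$, equipped with the product topology of the discrete topology on $\{0,1\}$ (so it is homeomorphic to the Cantor space). Borel classes on $2^\omega$: $\mathbf{\Sigma}^0_1$ is the class of open sets, $\mathbf{\Pi}^0_1$ the class of closed sets, and for $k\geq 2$, $\mathbf{\Sigma}^0_k$ (respectively $\mathbf{\Pi}^0_k$) is the class of countable unions (respectively countable intersections) of sets in $\bigcup_{j<k}\mathbf{\Pi}^0_j$ (respectively $\bigcup_{j<k}\mathbf{\Sigma}^0_j$). Define $\mathcal{W}(\mathbf{\Sigma}^0_k) = \{A\subseteq 2^\star \mid A^\omega \text{ is a } \mathbf{\Sigma}^0_k\text{-subset of } 2^\omega\}$. For $\mathcal{A},\mathcal{B}\subseteq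 2^{2^\star}$, $\mathcal{A}\leq \mathcal{B}$ means that there is a continuous function $H:2^{2^\star}\to 2^{2^\star}$ with $\mathcal{A}=H^{-1}(\mathcal{B})$. *)

theory Defs
  imports "HOL-Analysis.Analysis"
begin

text \<open>Finite words over 2 are of type \<^typ>\<open>bool list\<close>, infinite words of type
  \<^typ>\<open>nat \<Rightarrow> bool\<close>, and dictionaries, identified with their characteristic functions, of type
  \<^typ>\<open>bool list \<Rightarrow> bool\<close>. On both function types the topology is the type class instance,
  which is the product topology over the discrete topology of \<^typ>\<open>bool\<close>.\<close>

text \<open>The infinite concatenation of \<open>u 0\<close>, \<open>u 1\<close>, \<open>u 2\<close>, ..., counting words from 0. It is
  meaningful only if all the words are nonempty: the first \<^term>\<open>Suc n\<close> of them
  then have total length at least \<^term>\<open>Suc n\<close>, so that letter \<open>n\<close> is already determined.\<close>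

definition inf_concat :: "(nat \<Rightarrow> 'a list) \<Rightarrow> nat \<Rightarrow> 'a" where
  "inf_concat u n = concat (map u [0..<Suc n]) ! n"

lemma length_concat_ge:
  assumes "\<And>i. u i \<noteq> []"
  shows "n \<le> length (concat (map u [0..<n]))"
proof (induction n)
  case (Suc n)
  have "length (u n) \<ge> 1"
    using assms[of n] by (cases "u n") auto
  with Suc show ?case by simp
qed simp

lemma concat_map_upt_prefix:
  assumes "m \<le> n"
  shows "\<exists>zs. concat (map u [0..<n]) = concat (map u [0..<m]) @ zs"
  using assms by (metis concat_append le_add_diff_inverse map_append upt_add_eq_append zero_le)

lemma inf_concat_prefix:
  assumes "\<And>i. u i \<noteq> []" and "j < length (concat (map u [0..<n]))"
  shows "inf_concat u j = concat (map u [0..<n]) ! j"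
proof -
  have j: "j < length (concat (map u [0..<Suc j]))"
    using length_concat_ge[of u "Suc j", OF assms(1)] by (rule Suc_le_lessD)
  consider "n \<le> Suc j" | "Suc j \<le> n" by linarith
  then show ?thesis
  proof cases
    case 1
    then show ?thesis
      using concat_map_upt_prefix[OF 1, of u] assms(2)
      unfolding inf_concat_def by (metis nth_append_left)
  next
    case 2
    then show ?thesis
      using concat_map_upt_prefix[OF 2, of u] j
      unfolding inf_concat_def by (metis nth_append_left)
  qed
qed

definition omega_power :: "'a list set \<Rightarrow> (nat \<Rightarrow> 'a) set" where
  "omega_power V = {inf_concat u | u. \<forall>i. u i \<in> V - {[]}}"

text \<open>The finite levels of the Borel hierarchy, which start at 1; level 0 is a dummy value.\<close>

fun Sigma0 :: "nat \<Rightarrow> 'a::topological_space set set"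
  and Pi0 :: "nat \<Rightarrow> 'a::topological_space set set" where
  "Sigma0 0 = {}"
| "Sigma0 (Suc 0) = {X. open X}"
| "Sigma0 (Suc (Suc n)) =
    {\<Union>\<C> | \<C>. countable \<C> \<and> \<C> \<subseteq> (\<Union>j\<in>{1..<Suc (Suc n)}. Pi0 j)}"
| "Pi0 0 = {}"
| "Pi0 (Suc 0) = {X. closed X}"
| "Pi0 (Suc (Suc n)) =
    {\<Inter>\<C> | \<C>. countable \<C> \<and> \<C> \<subseteq> (\<Union>j\<in>{1..<Suc (Suc n)}. Sigma0 j)}"

definition dict_class :: "(nat \<Rightarrow> bool) set set \<Rightarrow> (bool list \<Rightarrow> bool) set" where
  "dict_class \<Gamma> = {A. omega_power {w. A w} \<in> \<Gamma>}"

definition continuously_reducible ::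
  "'a::topological_space set \<Rightarrow> 'b::topological_space set \<Rightarrow> bool" where
  "continuously_reducible \<A> \<B> \<longleftrightarrow>
    (\<exists>H :: 'a \<Rightarrow> 'b. continuous_on UNIV H \<and> \<A> = H -` \<B>)"

end

theory Submission
  imports Defs
begin

text \<open>
  Read a word as a program for a stack of letters: \<open>1c\<close> pushes the letter \<open>c\<close>, and \<open>0\<close> pops.
  The reduction sends a dictionary \<open>A\<close> to the dictionary \<open>lift A\<close> of all programs that
  transform the empty stack into a nonempty word of \<open>A\<close>. Whether a program belongs to
  \<open>lift A\<close> depends on one value of \<open>A\<close> at most, so \<open>lift\<close> is continuous. An infinite
  program may have a limit stack \<open>y\<close>, each entry being changed only finitely often, and the
  \<open>\<omega>\<close>-power of \<open>lift A\<close> consists of the programs whose limit stack exists and lies in the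
  \<open>\<omega>\<close>-power of \<open>A\<close> (\<open>omega_power_lift\<close>). It remains to compare a set \<open>Y\<close> with the set \<open>X\<close> of all
  programs that have a limit stack in \<open>Y\<close>: for \<open>k \<ge> 3\<close>, \<open>Y\<close> is a \<open>\<Sigma>\<^sub>k\<close> set iff \<open>X\<close> is a
  \<open>\<Sigma>\<^sub>k\<^sub>+\<^sub>1\<close> set.

  Forming a limit costs one level at most. That a given word is eventually a prefix of the stack is
  a \<open>\<Sigma>\<^sub>2\<close> condition, so on the programs with a limit stack the preimage of a \<open>\<Sigma>\<^sub>k\<close> set
  is \<open>\<Sigma>\<^sub>k\<^sub>+\<^sub>1\<close> (\<open>limit_stack_pullback\<close>). Having a limit stack is a \<open>\<Pi>\<^sub>3\<close> condition
  (\<open>limit_stack_domain_Pi0_3\<close>), and intersecting with it preserves \<open>\<Sigma>\<^sub>k\<^sub>+\<^sub>1\<close> because \<open>k \<ge> 3\<close>.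

  Conversely, suppose that \<open>X\<close> is \<open>\<Sigma>\<^sub>k\<^sub>+\<^sub>1\<close>. Only countably many closed sets occur in a
  construction of \<open>X\<close>. As in Friedberg's jump inversion, every \<open>y\<close> gets a program \<open>g y\<close> with
  limit stack \<open>y\<close> that, in between pushing letters of \<open>y\<close>, decides membership in one of these
  closed sets after the other: it escapes from the closed set if some sequence of pushes and pops
  above the letters already written can do so, and in any case clears all that it has added
  (\<open>generic_section\<close>). The decision about the \<open>n\<close>-th set depends on the first \<open>n\<close> letters
  of \<open>y\<close> only, so its preimage under \<open>g\<close> is clopen. Therefore \<open>g\<close> pulls \<open>X\<close> back to a set one level
  lower (\<open>pullback_lowers_level\<close>), and that set is \<open>Y\<close>.
\<close>

section \<open>Cylinders\<close>

definition cylinder :: "'a list \<Rightarrow> (nat \<Rightarrow> 'a) set" where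
  "cylinder s = {x. map x [0..<length s] = s}"

lemma mem_cylinder_map [simp]: "x \<in> cylinder (map x [0..<n])"
  by (simp add: cylinder_def)

lemma mem_cylinder_iff: "x \<in> cylinder s \<longleftrightarrow> (\<forall>i<length s. x i = s ! i)"
  unfolding cylinder_def mem_Collect_eq list_eq_iff_nth_eq by simp

lemma cylinder_prefixI:
  assumes "map x [0..<n] = s @ t"
  shows "x \<in> cylinder s"
proof -
  have "n = length s + length t" using arg_cong[OF assms, of length] by simp
  then show ?thesis using assms by (simp add: cylinder_def upt_add_eq_append[of 0, simplified])
qed

lemma open_finite_dependence:
  fixes S :: "(nat \<Rightarrow> bool) set"
  assumes "\<And>x y. \<lbrakk>\<forall>i<n. x i = y i; x \<in> S\<rbrakk> \<Longrightarrow> y \<in> S"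
  shows "open S"
proof (subst open_subopen, intro ballI)
  fix x assume x: "x \<in> S"
  let ?T = "PiE UNIV (\<lambda>i. if i < n then {x i} else UNIV)"
  have "open ?T"
    by (rule open_PiE) (auto simp: open_discrete intro: finite_subset[of _ "{..<n}"])
  moreover have "?T \<subseteq> S"
  proof
    fix y assume "y \<in> ?T"
    then have "\<forall>i<n. x i = y i"
      by (auto simp: PiE_iff) (metis singletonD)+
    then show "y \<in> S" using assms x by blast
  qed
  ultimately show "\<exists>T. open T \<and> x \<in> T \<and> T \<subseteq> S"
    by (intro exI[of _ ?T]) auto
qed

lemma clopen_finite_dependence:
  fixes S :: "(nat \<Rightarrow> bool) set"
  assumes "\<And>x y. \<forall>i<n. x i = y i \<Longrightarrow> x \<in> S \<longleftrightarrow> y \<in> S"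
  shows "open S" "closed S"
  using open_finite_dependence[of n S] open_finite_dependence[of n "- S"] assms
  by (auto simp: closed_def)

lemma closed_cylinder:
  fixes s :: "bool list"
  shows "closed (cylinder s)"
proof (rule clopen_finite_dependence(2))
  show "x \<in> cylinder s \<longleftrightarrow> y \<in> cylinder s" if "\<forall>i<length s. x i = y i" for x y
    using that unfolding mem_cylinder_iff by simp
qed

lemma open_contains_cylinder:
  fixes U :: "(nat \<Rightarrow> bool) set"
  assumes "open U" "x \<in> U"
  obtains n where "cylinder (map x [0..<n]) \<subseteq> U"
proof -
  obtain X where X: "x \<in> PiE UNIV X" "finite {i. X i \<noteq> UNIV}" "PiE UNIV X \<subseteq> U"
    using product_topology_open_contains_basis[of "\<lambda>_. euclidean" UNIV U x] assms
    by (auto simp: open_fun_def)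
  obtain n where n: "\<And>i. X i \<noteq> UNIV \<Longrightarrow> i < n"
    using X(2) finite_nat_set_iff_bounded by auto
  have "cylinder (map x [0..<n]) \<subseteq> PiE UNIV X"
  proof
    fix y assume "y \<in> cylinder (map x [0..<n])"
    then have y: "\<And>i. i < n \<Longrightarrow> y i = x i"
      by (simp add: mem_cylinder_iff)
    have "y i \<in> X i" for i
      using y[of i] n[of i] X(1) by (cases "i < n") (auto simp: PiE_iff)
    then show "y \<in> PiE UNIV X" by (simp add: PiE_iff)
  qed
  then show ?thesis by (intro that) (rule order_trans[OF _ X(3)])
qed

lemma open_eq_Union_cylinder:
  fixes U :: "(nat \<Rightarrow> bool) set"
  assumes "open U"
  shows "U = (\<Union>s\<in>{s. cylinder s \<subseteq> U}. cylinder s)"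
proof (intro equalityI subsetI)
  fix x assume "x \<in> U"
  then obtain n where "cylinder (map x [0..<n]) \<subseteq> U"
    using open_contains_cylinder assms by blast
  then show "x \<in> (\<Union>s\<in>{s. cylinder s \<subseteq> U}. cylinder s)"
    by (intro UN_I[of "map x [0..<n]"]) auto
qed auto

section \<open>The finite Borel levels\<close>

lemma Pi0_iff_Compl_Sigma0: "X \<in> Pi0 n \<longleftrightarrow> - X \<in> Sigma0 n"
proof (induction n arbitrary: X rule: less_induct)
  case (less n)
  consider "n = 0" | "n = Suc 0" | m where "n = Suc (Suc m)"
    by (metis not0_implies_Suc)
  then show ?case
  proof cases
    case 3
    have S: "A \<in> Sigma0 j \<longleftrightarrow> - A \<in> Pi0 j" if "j < n" for A :: "'a set" and j
      using less[OF that, of "- A"] by simp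
    show ?thesis
    proof
      assume "X \<in> Pi0 n"
      then obtain C where C: "countable C" "C \<subseteq> (\<Union>j\<in>{1..<n}. Sigma0 j)" "X = \<Inter>C"
        using 3 by auto
      have "uminus ` C \<subseteq> (\<Union>j\<in>{1..<n}. Pi0 j)"
      proof (rule image_subsetI)
        fix c assume "c \<in> C"
        then obtain j where "j \<in> {1..<n}" "c \<in> Sigma0 j" using C(2) by blast
        then show "- c \<in> (\<Union>j\<in>{1..<n}. Pi0 j)" using S[of j c] by auto
      qed
      moreover have "- X = \<Union>(uminus ` C)" using C(3) by auto
      moreover have "countable (uminus ` C)" using C(1) by simp
      ultimately show "- X \<in> Sigma0 n"
        unfolding 3 Sigma0.simps by blast
    next
      assume "- X \<in> Sigma0 n"
      then obtain C where C: "countable C" "C \<subseteq> (\<Union>j\<in>{1..<n}. Pi0 j)" "- X = \<Union>C"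
        using 3 by auto
      have "uminus ` C \<subseteq> (\<Union>j\<in>{1..<n}. Sigma0 j)"
      proof (rule image_subsetI)
        fix c assume "c \<in> C"
        then obtain j where "j \<in> {1..<n}" "c \<in> Pi0 j" using C(2) by blast
        then show "- c \<in> (\<Union>j\<in>{1..<n}. Sigma0 j)" using less[of j c] by auto
      qed
      moreover have "X = \<Inter>(uminus ` C)" using C(3) by auto
      moreover have "countable (uminus ` C)" using C(1) by simp
      ultimately show "X \<in> Pi0 n"
        unfolding 3 Pi0.simps by blast
    qed
  qed (auto simp: closed_def)
qed

lemma Sigma0E:
  assumes "X \<in> Sigma0 n" "n \<ge> 2"
  obtains C where "countable C" "\<And>c. c \<in> C \<Longrightarrow> \<exists>j. 1 \<le> j \<and> j < n \<and> c \<in> Pi0 j" "X = \<Union>C"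
proof -
  obtain m where m: "n = Suc (Suc m)" using assms(2) by (metis add_2_eq_Suc le_Suc_ex)
  obtain C where C: "countable C" "C \<subseteq> (\<Union>j\<in>{1..<n}. Pi0 j)" "X = \<Union>C"
    using assms(1) unfolding m Sigma0.simps mem_Collect_eq by (elim exE conjE)
  have "\<exists>j. 1 \<le> j \<and> j < n \<and> c \<in> Pi0 j" if "c \<in> C" for c
    using subsetD[OF C(2) that] by auto
  then show ?thesis using that C(1,3) by metis
qed

lemma Sigma0I:
  assumes "countable C" "\<And>c. c \<in> C \<Longrightarrow> \<exists>j. 1 \<le> j \<and> j < n \<and> c \<in> Pi0 j" "X = \<Union>C" "n \<ge> 2"
  shows "X \<in> Sigma0 n"
proof -
  obtain m where m: "n = Suc (Suc m)" using assms(4) by (metis add_2_eq_Suc le_Suc_ex)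
  have "C \<subseteq> (\<Union>j\<in>{1..<n}. Pi0 j)"
  proof
    fix c assume "c \<in> C"
    then show "c \<in> (\<Union>j\<in>{1..<n}. Pi0 j)" using assms(2)[of c] by auto
  qed
  then show ?thesis unfolding m Sigma0.simps using assms(1,3) by blast
qed

lemma Pi0_imp_Sigma0:
  assumes "X \<in> Pi0 j" "1 \<le> j" "j < n"
  shows "X \<in> Sigma0 n"
  by (rule Sigma0I[of "{X}"]) (use assms in auto)

lemma Sigma0_UN:
  assumes "countable I" "n \<ge> 1" "\<And>i. i \<in> I \<Longrightarrow> B i \<in> Sigma0 n"
  shows "(\<Union>i\<in>I. B i) \<in> Sigma0 n"
proof (cases "n = 1")
  case True
  then show ?thesis using assms by auto
next
  case False
  with assms have n: "n \<ge> 2" by simp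
  have "\<forall>i\<in>I. \<exists>C. countable C \<and> (\<forall>c\<in>C. \<exists>j. 1 \<le> j \<and> j < n \<and> c \<in> Pi0 j) \<and> B i = \<Union>C"
  proof
    fix i assume "i \<in> I"
    then show "\<exists>C. countable C \<and> (\<forall>c\<in>C. \<exists>j. 1 \<le> j \<and> j < n \<and> c \<in> Pi0 j) \<and> B i = \<Union>C"
      using Sigma0E[OF assms(3) n] by metis
  qed
  from bchoice[OF this] obtain C where C: "\<forall>i\<in>I. countable (C i) \<and>
      (\<forall>c\<in>C i. \<exists>j. 1 \<le> j \<and> j < n \<and> c \<in> Pi0 j) \<and> B i = \<Union>(C i)" ..
  show ?thesis
  proof (rule Sigma0I)
    show "countable (\<Union>i\<in>I. C i)" using assms(1) C by simp
    show "\<exists>j. 1 \<le> j \<and> j < n \<and> c \<in> Pi0 j" if "c \<in> (\<Union>i\<in>I. C i)" for c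
      using that C by auto
    show "(\<Union>i\<in>I. B i) = \<Union>(\<Union>i\<in>I. C i)" using C by auto
  qed (rule n)
qed

lemma Pi0_INT:
  assumes "countable I" "n \<ge> 1" "\<And>i. i \<in> I \<Longrightarrow> B i \<in> Pi0 n"
  shows "(\<Inter>i\<in>I. B i) \<in> Pi0 n"
  using Sigma0_UN[of I n "\<lambda>i. - B i"] assms by (simp add: Pi0_iff_Compl_Sigma0)

text \<open>The classes are cumulative from level 2 on by their very definition; the step from
  level 1 to level 2 is where the topology enters. Here open sets are countable unions of
  cylinders, and those are closed.\<close>

lemma open_imp_Sigma0_2:
  fixes U :: "(nat \<Rightarrow> bool) set"
  assumes "open U"
  shows "U \<in> Sigma0 2"
proof -
  have "(\<Union>s\<in>{s. cylinder s \<subseteq> U}. cylinder s) \<in> Sigma0 2"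
    by (rule Sigma0_UN) (auto intro!: Pi0_imp_Sigma0[of _ 1] closed_cylinder)
  then show ?thesis using open_eq_Union_cylinder[OF assms] by simp
qed

lemma Sigma0_mono:
  fixes X :: "(nat \<Rightarrow> bool) set"
  assumes "X \<in> Sigma0 j" "1 \<le> j" "j \<le> n"
  shows "X \<in> Sigma0 n"
proof -
  have *: "X \<in> Sigma0 n" if j: "X \<in> Sigma0 j" "2 \<le> j" "j \<le> n" for j
  proof -
    obtain C where C: "countable C" "\<And>c. c \<in> C \<Longrightarrow> \<exists>i. 1 \<le> i \<and> i < j \<and> c \<in> Pi0 i" "X = \<Union>C"
      using Sigma0E[OF j(1,2)] by metis
    show ?thesis
    proof (rule Sigma0I)
      fix c assume "c \<in> C"
      then show "\<exists>i. 1 \<le> i \<and> i < n \<and> c \<in> Pi0 i"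
        using C(2) j(3) order_less_le_trans by blast
    qed (use C j in auto)
  qed
  show ?thesis
  proof (cases "j = 1 \<and> n \<noteq> 1")
    case True
    then have "X \<in> Sigma0 2" "n \<ge> 2" using assms open_imp_Sigma0_2 by auto
    then show ?thesis using * by blast
  next
    case False
    then show ?thesis using assms *[of j] by (cases "j = n") auto
  qed
qed

lemma Pi0_mono:
  fixes X :: "(nat \<Rightarrow> bool) set"
  assumes "X \<in> Pi0 j" "1 \<le> j" "j \<le> n"
  shows "X \<in> Pi0 n"
  using assms Sigma0_mono by (simp add: Pi0_iff_Compl_Sigma0)

lemma Sigma0_Int_Pi0:
  fixes S :: "(nat \<Rightarrow> bool) set"
  assumes "S \<in> Sigma0 (Suc n)" "D \<in> Pi0 n" "n \<ge> 1"
  shows "S \<inter> D \<in> Sigma0 (Suc n)"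
proof -
  have "Suc n \<ge> 2" using assms(3) by simp
  then obtain C where C: "countable C" "\<And>c. c \<in> C \<Longrightarrow> \<exists>j. 1 \<le> j \<and> j < Suc n \<and> c \<in> Pi0 j" "S = \<Union>C"
    using Sigma0E[OF assms(1)] by metis
  have "c \<inter> D \<in> Pi0 n" if c: "c \<in> C" for c
  proof -
    have "c \<in> Pi0 n" using C(2)[OF c] Pi0_mono less_Suc_eq_le by blast
    then have "(\<Inter>i\<in>{c, D}. i) \<in> Pi0 n" by (intro Pi0_INT) (use assms in auto)
    then show ?thesis by simp
  qed
  with C(1) have "(\<Union>c\<in>C. c \<inter> D) \<in> Sigma0 (Suc n)"
    using assms(3) by (intro Sigma0_UN Pi0_imp_Sigma0[of _ n]) auto
  moreover have "S \<inter> D = (\<Union>c\<in>C. c \<inter> D)" unfolding C(3) by blast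
  ultimately show ?thesis by simp
qed

section \<open>Infinite concatenations\<close>

lemma inf_concat_unique:
  assumes "\<And>i. u i \<noteq> []"
    and "\<And>n. concat (map u [0..<n]) = map x [0..<length (concat (map u [0..<n]))]"
  shows "inf_concat u = x"
proof
  fix j
  have j: "j < length (concat (map u [0..<Suc j]))"
    using length_concat_ge[of u "Suc j", OF assms(1)] by simp
  show "inf_concat u j = x j"
    unfolding inf_concat_def by (subst assms(2)) (use j in simp)
qed

lemma concat_eq_map_inf_concat:
  assumes "\<And>i. u i \<noteq> []"
  shows "concat (map u [0..<n]) = map (inf_concat u) [0..<length (concat (map u [0..<n]))]"
  by (rule nth_equalityI)
    (auto simp del: length_concat simp: inf_concat_prefix[OF assms])

lemma concat_map_upt_split:
  assumes "n \<le> N"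
  shows "concat (map u [0..<N]) = concat (map u [0..<n]) @ concat (map u [n..<N])"
  using assms by (metis concat_append le_add_diff_inverse map_append upt_add_eq_append zero_le)

section \<open>The stack machine\<close>

text \<open>A state is a stack, its top at the end of the list, together with a flag that is set
  after the letter \<open>True\<close> of the push instruction \<open>[True, c]\<close> has been read and \<open>c\<close> is still to come. The
  pop instruction is the single letter \<open>False\<close>. Popping the empty stack fails for good; hence no word
  that runs successfully from the empty stack can erase letters written before it, and lifted words
  can be concatenated.\<close>

fun step :: "(bool list \<times> bool) option \<Rightarrow> bool \<Rightarrow> (bool list \<times> bool) option" where
  "step None c = None"
| "step (Some (s, True)) c = Some (s @ [c], False)"
| "step (Some (s, False)) True = Some (s, True)"
| "step (Some (s, False)) False = (if s = [] then None else Some (butlast s, False))"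

definition run :: "bool list \<Rightarrow> (bool list \<times> bool) option" where
  "run w = foldl step (Some ([], False)) w"

definition state :: "(nat \<Rightarrow> bool) \<Rightarrow> nat \<Rightarrow> (bool list \<times> bool) option" where
  "state x m = run (map x [0..<m])"

definition extends :: "bool list \<Rightarrow> (bool list \<times> bool) option \<Rightarrow> bool" where
  "extends s q \<longleftrightarrow> (\<exists>r p. q = Some (s @ r, p))"

definition settles :: "(nat \<Rightarrow> bool) \<Rightarrow> bool list \<Rightarrow> bool" where
  "settles x s \<longleftrightarrow> (\<exists>M. \<forall>m\<ge>M. extends s (state x m))"

definition limit_stack :: "(nat \<Rightarrow> bool) \<Rightarrow> (nat \<Rightarrow> bool) \<Rightarrow> bool" where
  "limit_stack x y \<longleftrightarrow> (\<forall>n. settles x (map y [0..<n]))"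

lemma state_0 [simp]: "state x 0 = Some ([], False)"
  by (simp add: state_def run_def)

lemma state_Suc: "state x (Suc m) = step (state x m) (x m)"
  by (simp add: state_def run_def)

lemma foldl_step_None [simp]: "foldl step None w = None"
  by (induction w) auto

lemma state_None_mono:
  assumes "state x m = None" "m \<le> n"
  shows "state x n = None"
  using assms(2,1) by (induction n rule: dec_induct) (auto simp: state_Suc)

lemma run_append_None: "run u = None \<Longrightarrow> run (u @ w) = None"
  by (simp add: run_def)

lemma run_append: "run u = Some (v, False) \<Longrightarrow> run (u @ w) = foldl step (Some (v, False)) w"
  by (simp add: run_def)

lemma extends_appendD: "extends (s @ t) q \<Longrightarrow> extends s q"
  by (auto simp: extends_def)

lemma extends_length_unique:
  "\<lbrakk>extends s q; extends t q; length s = length t\<rbrakk> \<Longrightarrow> s = t"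
  by (auto simp: extends_def)

text \<open>A step that leaves the bottom part \<open>r\<close> of the stack in place does not depend on \<open>r\<close>.
  From left to right this would fail for a pop that removes the last letter of \<open>r\<close>, but then the result
  is not of the form \<open>r @ t\<close>.\<close>

lemma step_frame:
  "step (Some (r @ s, p)) c = Some (r @ t, q) \<longleftrightarrow> step (Some (s, p)) c = Some (t, q)"
proof (cases p; cases c)
  assume *: "\<not> p" "\<not> c"
  have "r = []" if "butlast r = r @ t"
  proof -
    have "length r - 1 = length r + length t"
      using that by (metis length_append length_butlast)
    then show ?thesis by (cases r) auto
  qed
  with * show ?thesis by (auto simp: butlast_append)
qed auto

lemma foldl_step_frame:
  "foldl step (Some (s, p)) w = Some (t, q) \<Longrightarrow> foldl step (Some (r @ s, p)) w = Some (r @ t, q)"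
proof (induction w arbitrary: s p)
  case (Cons c w)
  then obtain s' p' where s': "step (Some (s, p)) c = Some (s', p')"
    by (cases "step (Some (s, p)) c") auto
  then show ?case
    using Cons step_frame[of r s p c s' p'] by simp
qed simp

lemma run_append_frame:
  assumes "run u = Some (v, False)" "run w = Some (t, q)"
  shows "run (u @ w) = Some (v @ t, q)"
  using foldl_step_frame[of "[]" False w t q v] assms
  by (simp add: run_append) (simp add: run_def)

lemma run_concat:
  assumes "\<And>i. run (u i) = Some (v i, False)"
  shows "run (concat (map u js)) = Some (concat (map v js), False)"
proof (induction js)
  case (Cons i js)
  then show ?case using run_append_frame[OF assms] by simp
qed (simp add: run_def)

text \<open>While the stack keeps the bottom part \<open>r\<close>, the letters read meanwhile act like a
  program of their own, started on the empty stack.\<close>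

lemma state_unframe:
  assumes T: "state x T = Some (r, False)"
    and ext: "\<And>m. m \<ge> T \<Longrightarrow> extends r (state x m)"
    and "m \<ge> T" "state x m = Some (r @ t, q)"
  shows "run (map x [T..<m]) = Some (t, q)"
  using assms(3,4)
proof (induction m arbitrary: t q rule: dec_induct)
  case base
  then show ?case using T by (simp add: run_def)
next
  case (step m)
  obtain s p where s: "state x m = Some (r @ s, p)"
    using ext[OF step.hyps(1)] by (auto simp: extends_def)
  then have "Submission.step (Some (s, p)) (x m) = Some (t, q)"
    using step.prems step_frame by (simp add: state_Suc)
  then show ?case
    using step.IH[OF s] step.hyps(1) by (simp add: run_def)
qed

text \<open>Whatever a program has built up can be removed again. This is what makes experiments
  free of charge in the construction of \<open>generic_section\<close>.\<close>

lemma run_erasable: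
  assumes "run w \<noteq> None"
  shows "\<exists>e. run (w @ e) = Some ([], False)"
proof -
  have pop: "\<exists>e. foldl step (Some (s, False)) e = Some ([], False)" for s
  proof (induction s rule: rev_induct)
    case Nil
    show ?case by (rule exI[of _ "[]"]) simp
  next
    case (snoc a s)
    then obtain e where "foldl step (Some (s, False)) e = Some ([], False)" by blast
    then show ?case by (intro exI[of _ "False # e"]) simp
  qed
  obtain s p where sp: "run w = Some (s, p)" using assms by auto
  show ?thesis
  proof (cases p)
    case True
    obtain e where "foldl step (Some (s @ [True], False)) e = Some ([], False)"
      using pop by blast
    then show ?thesis using sp True by (intro exI[of _ "True # e"]) (simp add: run_def)
  next
    case False
    obtain e where "foldl step (Some (s, False)) e = Some ([], False)"
      using pop by blast
    then show ?thesis using sp False by (intro exI[of _ e]) (simp add: run_def)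
  qed
qed

lemma limit_stack_unique:
  assumes "limit_stack x y" "limit_stack x z"
  shows "y = z"
proof
  fix i
  obtain M where M: "\<forall>m\<ge>M. extends (map y [0..<Suc i]) (state x m)"
    using assms(1) unfolding limit_stack_def settles_def by blast
  obtain N where N: "\<forall>m\<ge>N. extends (map z [0..<Suc i]) (state x m)"
    using assms(2) unfolding limit_stack_def settles_def by blast
  have "map y [0..<Suc i] = map z [0..<Suc i]"
    by (rule extends_length_unique[of _ "state x (max M N)"]) (use M N in auto)
  then show "y i = z i" by simp
qed

lemma settles_limit_stack:
  assumes "limit_stack x y" "settles x s"
  shows "s = map y [0..<length s]"
proof -
  obtain M where M: "\<forall>m\<ge>M. extends s (state x m)"
    using assms(2) unfolding settles_def by blast
  obtain N where N: "\<forall>m\<ge>N. extends (map y [0..<length s]) (state x m)"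
    using assms(1) unfolding limit_stack_def settles_def by blast
  show ?thesis
    by (rule extends_length_unique[of _ "state x (max M N)"]) (use M N in auto)
qed

lemma settles_takeD: "settles x s \<Longrightarrow> settles x (take n s)"
  unfolding settles_def by (metis append_take_drop_id extends_appendD)

text \<open>Once the first \<open>n\<close> programs are finished, the later ones run successfully on top of what
  has been written and hence never touch it.\<close>

lemma limit_stack_inf_concat:
  assumes run: "\<And>i. run (u i) = Some (v i, False)" and v: "\<And>i. v i \<noteq> []"
  shows "limit_stack (inf_concat u) (inf_concat v)"
proof -
  have u: "u i \<noteq> []" for i
    using run[of i] v[of i] by (auto simp: run_def)
  let ?U = "\<lambda>n. concat (map u [0..<n])" and ?V = "\<lambda>n. concat (map v [0..<n])"
  have "settles (inf_concat u) (?V n)" for n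
    unfolding settles_def
  proof (intro exI[of _ "length (?U n)"] allI impI)
    fix m assume m: "m \<ge> length (?U n)"
    \<comment> \<open>At time \<open>m\<close> nothing beyond the first \<open>N\<close> programs has been read.\<close>
    define N where "N = max n m"
    have N: "n \<le> N" "m \<le> length (?U N)"
      using length_concat_ge[OF u, of N] by (auto simp: N_def)
    let ?w = "concat (map u [n..<N])" and ?k = "m - length (?U n)"
    have split: "?U N = ?U n @ ?w"
      by (rule concat_map_upt_split[OF N(1)])
    have "map (inf_concat u) [0..<m] = take m (?U N)"
      using N(2) by (subst concat_eq_map_inf_concat[OF u]) (simp add: take_map take_upt)
    also have "\<dots> = ?U n @ take ?k ?w"
      using m by (simp add: split)
    finally have pre: "state (inf_concat u) m = run (?U n @ take ?k ?w)"
      by (simp add: state_def)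
    have "run (take ?k ?w) \<noteq> None"
      using run_concat[of u v "[n..<N]", OF run] run_append_None[of "take ?k ?w" "drop ?k ?w"]
      by (metis append_take_drop_id option.distinct(1))
    then obtain t q where "run (take ?k ?w) = Some (t, q)" by fast
    from run_append_frame[OF _ this] run_concat[of u v "[0..<n]", OF run]
    show "extends (?V n) (state (inf_concat u) m)"
      by (auto simp: pre extends_def)
  qed
  moreover have "map (inf_concat v) [0..<n] = take n (?V n)" for n
    using length_concat_ge[OF v, of n]
    by (subst concat_eq_map_inf_concat[OF v]) (simp add: take_map take_upt)
  ultimately show ?thesis
    unfolding limit_stack_def by (metis settles_takeD)
qed

text \<open>There is a first time from which on the first \<open>n\<close> letters of the limit stack are
  untouched, and at this time they are all that is on the stack: unless \<open>n = 0\<close>, they have just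
  been completed, and only a push can do that.\<close>

lemma limit_stack_cut:
  assumes "limit_stack x y"
  obtains T where "state x T = Some (map y [0..<n], False)"
    and "\<And>m. m \<ge> T \<Longrightarrow> extends (map y [0..<n]) (state x m)"
    and "\<And>M. (\<And>m. m \<ge> M \<Longrightarrow> extends (map y [0..<n]) (state x m)) \<Longrightarrow> T \<le> M"
proof -
  let ?s = "map y [0..<n]"
  let ?P = "\<lambda>M. \<forall>m\<ge>M. extends ?s (state x m)"
  define T where "T = (LEAST M. ?P M)"
  have "\<exists>M. ?P M" using assms unfolding limit_stack_def settles_def by blast
  then have T: "?P T" unfolding T_def by (rule LeastI_ex)
  have least: "T \<le> M" if "?P M" for M unfolding T_def by (rule Least_le[of ?P, OF that])
  have "state x T = Some (?s, False)"
  proof (cases T)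
    case 0
    then have "extends ?s (state x 0)" using T by blast
    then show ?thesis using 0 by (auto simp: extends_def)
  next
    case (Suc M)
    have now: "extends ?s (state x T)" using T by blast
    have before: "\<not> extends ?s (state x M)"
    proof
      assume "extends ?s (state x M)"
      then have "?P M" using T Suc by (metis le_antisym not_less_eq_eq)
      then show False using least[of M] Suc by simp
    qed
    obtain t p where t: "state x M = Some (t, p)"
      using now Suc by (cases "state x M") (auto simp: state_Suc extends_def)
    consider "p" | "\<not> p" "x M" | "\<not> p" "\<not> x M" by blast
    then show ?thesis
    proof cases
      case 1
      then obtain r where r: "t @ [x M] = ?s @ r" "state x T = Some (t @ [x M], False)"
        using now Suc t by (auto simp: state_Suc extends_def)
      show ?thesis
      proof (cases r rule: rev_cases)
        case Nil
        then show ?thesis using r by simp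
      next
        case (snoc r' a)
        then have "t = ?s @ r'" using r(1) by simp
        then show ?thesis using before t by (auto simp: extends_def)
      qed
    next
      case 2
      then show ?thesis using before now Suc t by (auto simp: state_Suc extends_def)
    next
      case 3
      then obtain r where "t \<noteq> []" "butlast t = ?s @ r"
        using now Suc t by (auto simp: state_Suc extends_def split: if_splits)
      then obtain r' where "t = ?s @ r'" by (metis append_assoc append_butlast_last_id)
      then show ?thesis using before t by (auto simp: extends_def)
    qed
  qed
  with T least that show ?thesis by blast
qed

section \<open>Lifting a dictionary\<close>

definition lift :: "(bool list \<Rightarrow> bool) \<Rightarrow> bool list \<Rightarrow> bool" where
  "lift A w \<longleftrightarrow> (\<exists>v. run w = Some (v, False) \<and> v \<noteq> [] \<and> A v)"

text \<open>Each value of \<^term>\<open>lift A\<close> is a value of \<open>A\<close> at a word that does not depend on \<open>A\<close>, or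
  is constantly \<open>False\<close>.\<close>

lemma continuous_lift: "continuous_on UNIV lift"
proof (rule continuous_on_coordinatewise_then_product)
  fix w
  show "continuous_on UNIV (\<lambda>A. lift A w)"
  proof (cases "\<exists>v. run w = Some (v, False) \<and> v \<noteq> []")
    case True
    then obtain v where "run w = Some (v, False)" "v \<noteq> []" by blast
    then have "lift A w = A v" for A by (simp add: lift_def)
    then show ?thesis by simp
  next
    case False
    then have "\<not> lift A w" for A by (auto simp: lift_def)
    then show ?thesis by simp
  qed
qed

text \<open>For the difficult inclusion, a factorization of the limit stack is carried over to the
  program by cutting it at the times given by \<open>limit_stack_cut\<close>.\<close>

lemma omega_power_lift:
  "omega_power {w. lift A w} = {x. \<exists>y\<in>omega_power {v. A v}. limit_stack x y}"
proof (intro equalityI subsetI)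
  fix x assume "x \<in> omega_power {w. lift A w}"
  then obtain u where u: "x = inf_concat u" "\<And>i. lift A (u i)"
    by (auto simp: omega_power_def)
  then obtain v where v: "\<And>i. run (u i) = Some (v i, False)" "\<And>i. v i \<noteq> []" "\<And>i. A (v i)"
    unfolding lift_def by metis
  then have "inf_concat v \<in> omega_power {v. A v}"
    unfolding omega_power_def by blast
  moreover have "limit_stack x (inf_concat v)"
    using limit_stack_inf_concat[of u v, OF v(1,2)] u(1) by simp
  ultimately show "x \<in> {x. \<exists>y\<in>omega_power {v. A v}. limit_stack x y}" by blast
next
  fix x assume "x \<in> {x. \<exists>y\<in>omega_power {v. A v}. limit_stack x y}"
  then obtain v where lim: "limit_stack x (inf_concat v)"
    and v: "\<And>i. v i \<noteq> []" "\<And>i. A (v i)"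
    by (auto simp: omega_power_def)
  let ?y = "inf_concat v" and ?V = "\<lambda>n. concat (map v [0..<n])"
  have "\<exists>T. state x T = Some (?V n, False)
      \<and> (\<forall>m\<ge>T. extends (?V n) (state x m))
      \<and> (\<forall>M. (\<forall>m\<ge>M. extends (?V n) (state x m)) \<longrightarrow> T \<le> M)" for n
    using limit_stack_cut[OF lim, of "length (?V n)"]
    unfolding concat_eq_map_inf_concat[OF v(1), symmetric] by metis
  then obtain T where T: "\<And>n. state x (T n) = Some (?V n, False)"
      "\<And>n m. m \<ge> T n \<Longrightarrow> extends (?V n) (state x m)"
      "\<And>n M. (\<And>m. m \<ge> M \<Longrightarrow> extends (?V n) (state x m)) \<Longrightarrow> T n \<le> M"
    by metis
  \<comment> \<open>No program with a limit stack ever fails, as failure is permanent; so the empty prefix is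
    undisturbed from time 0 on and nothing precedes the first cut.\<close>
  have T0: "T 0 = 0"
  proof -
    have "extends [] (state x m)" for m
      using T(2)[of 0 "max (T 0) m"] state_None_mono[of x m "max (T 0) m"]
      by (cases "state x m") (auto simp: extends_def)
    then show ?thesis using T(3)[of 0 0] by simp
  qed
  \<comment> \<open>Minimality makes the cuts monotone, and different stacks at the cuts make them distinct.\<close>
  have T_less: "T n < T (Suc n)" for n
  proof -
    have "T n \<le> T (Suc n)"
      using T(2)[of "Suc n"] by (intro T(3)) (auto dest: extends_appendD)
    moreover have "T n \<noteq> T (Suc n)"
      using T(1)[of n] T(1)[of "Suc n"] v(1)[of n] by auto
    ultimately show ?thesis by simp
  qed
  define u where "u n = map x [T n..<T (Suc n)]" for n
  have "run (u n) = Some (v n, False)" for n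
    unfolding u_def
    by (rule state_unframe[OF T(1) T(2)]) (use T(1)[of "Suc n"] T_less[of n] in auto)
  then have lift: "lift A (u n)" for n using v by (auto simp: lift_def)
  have u: "u n \<noteq> []" for n using T_less[of n] by (simp add: u_def)
  have "concat (map u [0..<n]) = map x [0..<T n]" for n
  proof (induction n)
    case (Suc n)
    have "[0..<T (Suc n)] = [0..<T n] @ [T n..<T (Suc n)]"
      using T_less[of n] upt_add_eq_append[of 0 "T n" "T (Suc n) - T n"] by simp
    then show ?case using Suc by (simp add: u_def)
  qed (simp add: T0)
  then have "inf_concat u = x" by (intro inf_concat_unique[OF u]) simp
  then show "x \<in> omega_power {w. lift A w}"
    using lift u unfolding omega_power_def by blast
qed

section \<open>Limit stacks raise the Borel level by at most one\<close>

lemma closed_extends: "closed {x. extends s (state x m)}"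
proof (rule clopen_finite_dependence(2))
  show "x \<in> {x. extends s (state x m)} \<longleftrightarrow> y \<in> {x. extends s (state x m)}"
    if "\<forall>i<m. x i = y i" for x y
  proof -
    have "map x [0..<m] = map y [0..<m]" using that by simp
    then show ?thesis by (simp only: state_def mem_Collect_eq)
  qed
qed

lemma settles_Sigma0_2: "{x. settles x s} \<in> Sigma0 2"
proof -
  have "{x. settles x s} = (\<Union>M. \<Inter>m\<in>{M..}. {x. extends s (state x m)})"
    by (auto simp: settles_def)
  moreover have "(\<Inter>m\<in>{M..}. {x. extends s (state x m)}) \<in> Sigma0 2" for M
    by (rule Pi0_imp_Sigma0[of _ 1]) (auto intro!: closed_INT closed_extends)
  ultimately show ?thesis by (auto intro!: Sigma0_UN)
qed

text \<open>A limit stack is assembled from one word of each length that settles; these words are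
  prefixes of each other, since they are prefixes of the same stack at all late times.\<close>

lemma limit_stack_domain:
  "(\<exists>y. limit_stack x y) \<longleftrightarrow> (\<forall>n. \<exists>s. length s = n \<and> settles x s)"
proof
  assume "\<exists>y. limit_stack x y"
  then show "\<forall>n. \<exists>s. length s = n \<and> settles x s"
    unfolding limit_stack_def by (metis length_map length_upt diff_zero)
next
  assume "\<forall>n. \<exists>s. length s = n \<and> settles x s"
  then obtain s where s: "\<And>n. length (s n) = n" "\<And>n. settles x (s n)" by metis
  have coh: "take n (s m) = s n" if "n \<le> m" for n m
  proof -
    obtain M where M: "\<forall>m'\<ge>M. extends (take n (s m)) (state x m')"
      using settles_takeD[OF s(2)[of m], of n] unfolding settles_def by blast
    obtain N where N: "\<forall>m'\<ge>N. extends (s n) (state x m')"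
      using s(2)[of n] unfolding settles_def by blast
    show ?thesis
      by (rule extends_length_unique[of _ "state x (max M N)"]) (use M N s(1) that in auto)
  qed
  have "map (\<lambda>i. s (Suc i) ! i) [0..<n] = s n" for n
  proof (rule nth_equalityI)
    fix i assume "i < length (map (\<lambda>i. s (Suc i) ! i) [0..<n])"
    then have "i < n" by simp
    then show "map (\<lambda>i. s (Suc i) ! i) [0..<n] ! i = s n ! i"
      using coh[of "Suc i" n] by (metis (no_types, lifting) Suc_leI add_0 diff_zero lessI nth_map_upt nth_take)
  qed (simp_all add: s)
  then show "\<exists>y. limit_stack x y"
    unfolding limit_stack_def using s(2) by metis
qed

lemma limit_stack_domain_Pi0_3: "{x. \<exists>y. limit_stack x y} \<in> Pi0 3"
proof -
  have "{x. \<exists>y. limit_stack x y} = (\<Inter>n. \<Union>s\<in>{s. length s = n}. {x. settles x s})"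
    unfolding limit_stack_domain by auto
  moreover have "(\<Union>s\<in>{s. length s = n}. {x. settles x s}) \<in> Sigma0 2" for n
    by (rule Sigma0_UN) (auto intro: settles_Sigma0_2)
  then have "(\<Union>s\<in>{s. length s = n}. {x. settles x s}) \<in> Pi0 3" for n
    using Pi0_imp_Sigma0[of "- (\<Union>s\<in>{s. length s = n}. {x. settles x s})" 2 3]
    by (simp add: Pi0_iff_Compl_Sigma0)
  ultimately show ?thesis by (auto intro!: Pi0_INT)
qed

text \<open>An open set is a union of cylinders, and the limit lies in a cylinder iff the word
  defining it settles, which is a \<open>\<Sigma>\<^sub>2\<close> condition. From there on the level on the side of the programs
  stays one ahead, by induction. Equivalence is asserted only for programs that have a limit stack,
  so that complements can be taken without regard to the domain.\<close>

lemma limit_stack_pullback: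
  assumes "Y \<in> Sigma0 n" "n \<ge> 1"
  shows "\<exists>S\<in>Sigma0 (Suc n). \<forall>x y. limit_stack x y \<longrightarrow> (x \<in> S \<longleftrightarrow> y \<in> Y)"
  using assms
proof (induction n arbitrary: Y rule: less_induct)
  case (less n)
  show ?case
  proof (cases "n = 1")
    case True
    then have "open Y" using less.prems by simp
    let ?S = "\<Union>s\<in>{s. cylinder s \<subseteq> Y}. {x. settles x s}"
    have "?S \<in> Sigma0 (Suc n)"
      using settles_Sigma0_2 True by (intro Sigma0_UN) (auto simp: numeral_2_eq_2)
    moreover have "x \<in> ?S \<longleftrightarrow> y \<in> Y" if lim: "limit_stack x y" for x y
    proof
      assume "x \<in> ?S"
      then obtain s where s: "cylinder s \<subseteq> Y" "settles x s" by blast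
      from settles_limit_stack[OF lim s(2)] have "y \<in> cylinder s" by (simp add: cylinder_def)
      then show "y \<in> Y" using s(1) by blast
    next
      assume "y \<in> Y"
      then obtain n where "cylinder (map y [0..<n]) \<subseteq> Y"
        using open_contains_cylinder \<open>open Y\<close> by blast
      then show "x \<in> ?S" using lim by (auto simp: limit_stack_def)
    qed
    ultimately show ?thesis by blast
  next
    case False
    then have n: "n \<ge> 2" using less.prems by simp
    obtain C where C: "countable C" "\<And>c. c \<in> C \<Longrightarrow> \<exists>j. 1 \<le> j \<and> j < n \<and> c \<in> Pi0 j" "Y = \<Union>C"
      using Sigma0E[OF less.prems(1) n] by metis
    have "\<forall>c\<in>C. \<exists>S\<in>Sigma0 (Suc n). \<forall>x y. limit_stack x y \<longrightarrow> (x \<in> S \<longleftrightarrow> y \<in> c)"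
    proof
      fix c assume "c \<in> C"
      then obtain j where j: "1 \<le> j" "j < n" "- c \<in> Sigma0 j"
        using C(2) Pi0_iff_Compl_Sigma0 by blast
      then obtain S where S: "S \<in> Sigma0 (Suc j)" "\<forall>x y. limit_stack x y \<longrightarrow> (x \<in> S \<longleftrightarrow> y \<in> - c)"
        using less.IH[of j "- c"] by blast
      have "- S \<in> Sigma0 (Suc n)"
        using S(1) j by (intro Pi0_imp_Sigma0[of _ "Suc j"]) (auto simp: Pi0_iff_Compl_Sigma0)
      then show "\<exists>S\<in>Sigma0 (Suc n). \<forall>x y. limit_stack x y \<longrightarrow> (x \<in> S \<longleftrightarrow> y \<in> c)"
        using S(2) by (intro bexI[of _ "- S"]) auto
    qed
    from bchoice[OF this[unfolded Bex_def]] obtain S where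
      S: "\<forall>c\<in>C. S c \<in> Sigma0 (Suc n) \<and> (\<forall>x y. limit_stack x y \<longrightarrow> (x \<in> S c \<longleftrightarrow> y \<in> c))" ..
    have "(\<Union>c\<in>C. S c) \<in> Sigma0 (Suc n)" using S C(1) by (intro Sigma0_UN) auto
    then show ?thesis using S C(3) by (intro bexI[of _ "\<Union>c\<in>C. S c"]) auto
  qed
qed

section \<open>A generic section lowers the Borel level by one\<close>

text \<open>A set of level \<open>n + 1\<close> is built from countably many closed sets by operations that
  commute with preimages. If the preimages of these closed sets are clopen, then the first
  step, the union of closed sets, yields an open set, and one level is saved.\<close>

lemma pullback_lowers_level:
  assumes "S \<in> Sigma0 (Suc n)" "n \<ge> 1"
  shows "\<exists>\<F>. countable \<F> \<and> (\<forall>F\<in>\<F>. closed F) \<and>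
    (\<forall>g :: 'b::topological_space \<Rightarrow> 'a::topological_space.
      (\<forall>F\<in>\<F>. open (g -` F) \<and> closed (g -` F)) \<longrightarrow> g -` S \<in> Sigma0 n)"
  using assms
proof (induction n arbitrary: S rule: less_induct)
  case (less n)
  let ?good = "\<lambda>\<F> S. countable \<F> \<and> (\<forall>F\<in>\<F>. closed F) \<and>
    (\<forall>g :: 'b \<Rightarrow> 'a. (\<forall>F\<in>\<F>. open (g -` F) \<and> closed (g -` F)) \<longrightarrow> g -` S \<in> Sigma0 n)"
  have "Suc n \<ge> 2" using less.prems(2) by simp
  then obtain C where C: "countable C" "\<And>c. c \<in> C \<Longrightarrow> \<exists>j. 1 \<le> j \<and> j < Suc n \<and> c \<in> Pi0 j" "S = \<Union>C"
    using Sigma0E[OF less.prems(1)] by metis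
  have "\<forall>c\<in>C. \<exists>\<F>. ?good \<F> c"
  proof
    fix c assume "c \<in> C"
    then obtain j where j: "1 \<le> j" "j < Suc n" "c \<in> Pi0 j" using C(2) by blast
    show "\<exists>\<F>. ?good \<F> c"
    proof (cases "j = 1")
      case True
      \<comment> \<open>Clopen sets serve at the bottom level as open sets and above it as closed sets.\<close>
      have "g -` c \<in> Sigma0 n" if "open (g -` c)" "closed (g -` c)" for g :: "'b \<Rightarrow> 'a"
        using that less.prems Pi0_imp_Sigma0[of "g -` c" 1 n] by (cases "n = 1") auto
      then show ?thesis using True j by (intro exI[of _ "{c}"]) auto
    next
      case False
      then obtain i where i: "j = Suc i" "1 \<le> i" "i < n"
        using j by (cases j) auto
      then obtain \<F> where \<F>: "countable \<F>" "\<forall>F\<in>\<F>. closed F"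
        "\<And>g :: 'b \<Rightarrow> 'a. (\<forall>F\<in>\<F>. open (g -` F) \<and> closed (g -` F)) \<Longrightarrow> g -` (- c) \<in> Sigma0 i"
        using less.IH[of i "- c"] j Pi0_iff_Compl_Sigma0 by blast
      have "g -` c \<in> Sigma0 n" if "\<forall>F\<in>\<F>. open (g -` F) \<and> closed (g -` F)" for g :: "'b \<Rightarrow> 'a"
        using \<F>(3)[OF that] i
        by (intro Pi0_imp_Sigma0[of _ i]) (auto simp: Pi0_iff_Compl_Sigma0 vimage_Compl)
      then show ?thesis using \<F>(1,2) by blast
    qed
  qed
  from bchoice[OF this] obtain \<F> where \<F>: "\<forall>c\<in>C. ?good (\<F> c) c" ..
  have "?good (\<Union>c\<in>C. \<F> c) S"
  proof (intro conjI allI impI)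
    show "countable (\<Union>c\<in>C. \<F> c)" using \<F> C(1) by simp
    show "\<forall>F\<in>\<Union>c\<in>C. \<F> c. closed F" using \<F> by simp
    fix g :: "'b \<Rightarrow> 'a" assume "\<forall>F\<in>\<Union>c\<in>C. \<F> c. open (g -` F) \<and> closed (g -` F)"
    then have "g -` c \<in> Sigma0 n" if "c \<in> C" for c
      using bspec[OF \<F> that] that by blast
    then have "(\<Union>c\<in>C. g -` c) \<in> Sigma0 n" using C(1) less.prems by (intro Sigma0_UN) auto
    then show "g -` S \<in> Sigma0 n" by (simp add: C(3) vimage_Union)
  qed
  then show ?case by (rule exI[where x = "\<Union>c\<in>C. \<F> c"])
qed

text \<open>The program \<open>g y\<close> is a concatenation of blocks. Block \<open>n\<close> first runs some program that
  leaves the stack as it was, chosen so that the closed set \<open>F n\<close> is avoided from then on if this is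
  possible at all, and then pushes the letter \<open>y n\<close>. If it is impossible, \<open>g y\<close> lies in \<open>F n\<close>: every
  prefix of \<open>g y\<close> can be continued in such a way that what was added since block \<open>n\<close> is erased, and so
  its cylinder meets \<open>F n\<close>, which is closed.\<close>

lemma generic_section:
  fixes F :: "nat \<Rightarrow> (nat \<Rightarrow> bool) set"
  assumes closed: "\<And>n. closed (F n)"
  obtains g where "\<And>y. limit_stack (g y) y"
    and "\<And>n. open (g -` F n)" "\<And>n. closed (g -` F n)"
proof -
  define avoids where "avoids n w t \<longleftrightarrow> run t = Some ([], False) \<and> cylinder (w @ t) \<inter> F n = {}"
    for n w t
  define pick where "pick n w = (if \<exists>t. avoids n w t then SOME t. avoids n w t else [])" for n w
  have pick_avoids: "avoids n w (pick n w)" if "\<exists>t. avoids n w t" for n w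
    using someI_ex[OF that] that by (simp add: pick_def)
  have pick: "run (pick n w) = Some ([], False)" for n w
  proof (cases "\<exists>t. avoids n w t")
    case True
    then show ?thesis using pick_avoids avoids_def by blast
  next
    case False
    then show ?thesis by (simp add: pick_def run_def)
  qed
  \<comment> \<open>\<open>W y n\<close> is the concatenation of the first \<open>n\<close> blocks \<open>u y\<close>; it depends on the first \<open>n\<close> letters of \<open>y\<close>.\<close>
  define W where "W y = rec_nat [] (\<lambda>n w. w @ pick n w @ [True, y n])" for y
  define u where "u y n = pick n (W y n) @ [True, y n]" for y n
  define g where "g y = inf_concat (u y)" for y
  have W_Suc: "W y (Suc n) = W y n @ u y n" for y n by (simp add: W_def u_def)
  have W_eq: "W y n = concat (map (u y) [0..<n])" for y n
    by (induction n) (simp_all add: W_Suc, simp add: W_def)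
  have u: "u y n \<noteq> []" for y n by (simp add: u_def)
  have run_u: "run (u y n) = Some ([y n], False)" for y n
    by (simp add: u_def run_append[OF pick])
  have lim: "limit_stack (g y) y" for y
  proof -
    have "inf_concat (\<lambda>n. [y n]) = y"
      by (rule inf_concat_unique) (auto simp: concat_map_singleton)
    then show ?thesis
      using limit_stack_inf_concat[of "u y" "\<lambda>n. [y n]"] run_u by (simp add: g_def)
  qed
  have W_cong: "W y n = W z n" if "\<forall>i<n. y i = z i" for y z n
    using that by (induction n) (simp_all add: W_def)
  have g_prefix: "W y n = map (g y) [0..<length (W y n)]" for y n
    unfolding W_eq g_def by (rule concat_eq_map_inf_concat[OF u])
  have decide: "g y \<in> F n \<longleftrightarrow> \<not> (\<exists>t. avoids n (W y n) t)" for y n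
  proof
    assume gF: "g y \<in> F n"
    show "\<not> (\<exists>t. avoids n (W y n) t)"
    proof
      let ?p = "W y n @ pick n (W y n)"
      assume "\<exists>t. avoids n (W y n) t"
      then have "cylinder ?p \<inter> F n = {}" using pick_avoids by (auto simp: avoids_def)
      moreover have "W y (Suc n) = ?p @ [True, y n]" by (simp add: W_Suc u_def)
      then have "g y \<in> cylinder ?p"
        using g_prefix[of y "Suc n"] by (metis cylinder_prefixI)
      ultimately show False using gF by blast
    qed
  next
    assume none: "\<not> (\<exists>t. avoids n (W y n) t)"
    show "g y \<in> F n"
    proof (rule ccontr)
      assume "g y \<notin> F n"
      then have "g y \<in> - F n" "open (- F n)" using closed by auto
      then obtain m where m: "cylinder (map (g y) [0..<m]) \<subseteq> - F n"
        using open_contains_cylinder by blast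
      \<comment> \<open>A neighbourhood of \<open>g y\<close> outside \<open>F n\<close> would be reached after \<open>N\<close> blocks, and erasing what
        blocks \<open>n\<close> to \<open>N - 1\<close> have pushed would yield a program avoiding \<open>F n\<close>.\<close>
      define N where "N = max n m"
      let ?t = "concat (map (u y) [n..<N])"
      have "run ?t \<noteq> None" using run_concat[where u = "u y" and v = "\<lambda>n. [y n]", OF run_u] by simp
      then obtain e where e: "run (?t @ e) = Some ([], False)" using run_erasable by blast
      have split: "W y N = W y n @ ?t"
        unfolding W_eq by (rule concat_map_upt_split) (simp add: N_def)
      have "cylinder (W y n @ ?t @ e) \<subseteq> cylinder (map (g y) [0..<m])"
      proof
        fix z assume "z \<in> cylinder (W y n @ ?t @ e)"
        then have "map z [0..<length (W y N @ e)] = W y N @ e"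
          by (simp add: cylinder_def split)
        then have "z \<in> cylinder (W y N)" by (metis cylinder_prefixI)
        moreover have "g y \<in> cylinder (W y N)"
          using g_prefix[of y N] by (simp add: cylinder_def)
        moreover have "m \<le> length (W y N)"
          using length_concat_ge[of "u y" N, OF u] by (simp add: W_eq N_def)
        ultimately show "z \<in> cylinder (map (g y) [0..<m])"
          by (simp add: mem_cylinder_iff)
      qed
      then have "avoids n (W y n) (?t @ e)" using m e by (auto simp: avoids_def)
      then show False using none by blast
    qed
  qed
  have "y \<in> g -` F n \<longleftrightarrow> z \<in> g -` F n" if "\<forall>i<n. y i = z i" for y z n
    using W_cong[OF that] by (simp add: decide)
  then have "open (g -` F n)" "closed (g -` F n)" for n
    by (rule clopen_finite_dependence[of n]; blast)+
  with lim that show ?thesis by blast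
qed

theorem proposition3p14:
  fixes k :: nat
  assumes "k \<ge> 3"
  shows "continuously_reducible (dict_class (Sigma0 k)) (dict_class (Sigma0 (k + 1)))"
proof -
  have "Y \<in> Sigma0 k \<longleftrightarrow> {x. \<exists>y\<in>Y. limit_stack x y} \<in> Sigma0 (Suc k)" (is "_ \<longleftrightarrow> ?X \<in> _")
    for Y :: "(nat \<Rightarrow> bool) set"
  proof
    assume "Y \<in> Sigma0 k"
    then obtain S where S: "S \<in> Sigma0 (Suc k)" "\<forall>x y. limit_stack x y \<longrightarrow> (x \<in> S \<longleftrightarrow> y \<in> Y)"
      using limit_stack_pullback[of Y k] assms by auto
    have "S \<inter> {x. \<exists>y. limit_stack x y} \<in> Sigma0 (Suc k)"
      using S(1) assms Pi0_mono[OF limit_stack_domain_Pi0_3, of k] by (intro Sigma0_Int_Pi0) auto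
    moreover have "S \<inter> {x. \<exists>y. limit_stack x y} = ?X" using S(2) by blast
    ultimately show "?X \<in> Sigma0 (Suc k)" by simp
  next
    assume "?X \<in> Sigma0 (Suc k)"
    then obtain \<F> where \<F>: "countable \<F>" "\<forall>F\<in>\<F>. closed F"
      "\<And>g :: (nat \<Rightarrow> bool) \<Rightarrow> nat \<Rightarrow> bool.
        (\<forall>F\<in>\<F>. open (g -` F) \<and> closed (g -` F)) \<Longrightarrow> g -` ?X \<in> Sigma0 k"
      using pullback_lowers_level[of ?X k] assms by auto
    \<comment> \<open>The empty set is added because an enumeration needs a nonempty set.\<close>
    define F where "F = from_nat_into (insert {} \<F>)"
    have range: "range F = insert {} \<F>" using \<F>(1) by (simp add: F_def range_from_nat_into)
    then have "closed (F n)" for n using \<F>(2) by (metis closed_empty insertE rangeI)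
    then obtain g where g: "\<And>y. limit_stack (g y) y" "\<And>n. open (g -` F n)" "\<And>n. closed (g -` F n)"
      using generic_section by blast
    have "\<forall>G\<in>\<F>. open (g -` G) \<and> closed (g -` G)"
      using g(2,3) range by (metis insertI2 rangeE)
    then have "g -` ?X \<in> Sigma0 k" by (rule \<F>(3))
    moreover have "y \<in> g -` ?X \<longleftrightarrow> y \<in> Y" for y
      using g(1)[of y] limit_stack_unique[OF g(1)[of y]] by blast
    then have "g -` ?X = Y" by blast
    ultimately show "Y \<in> Sigma0 k" by simp
  qed
  then have "dict_class (Sigma0 k) = lift -` dict_class (Sigma0 (k + 1))"
    by (auto simp: dict_class_def omega_power_lift)
  then show ?thesis
    unfolding continuously_reducible_def using continuous_lift by blast
qed

end
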